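(* Let $(\epsilon_1,\epsilon_2)\in\{(-1,-1),(-1,1),(1,-1)\}$ and $\epsilon=-\epsilon_1\epsilon_2$. Let $L$ be the simply connected Lie group with Lie algebra $\mathfrak{l}$, $\bar g$ the left-invariant metric on $L$ defined by $\langle\cdot,\cdot\rangle$, $\nabla$ its Levi-Civita connection, and $J_1,J_2,J_3$ the skew-symmetric endomorphisms of $\mathfrak{l}$, all as given in the context. Then for all $X\in\mathfrak{l}$ $$\begin{aligned} {[\nabla_X,J_1]}&=\hat\alpha(X)J_2+\hat\beta(X)J_3,\\ [\nabla_X,J_2]&=\epsilon\,\hat\alpha(X)J_1+\hat\gamma(X)J_3,\\ [\nabla_X,J_3]&=\epsilon_2\hat\beta(X)J_1+\epsilon_1\hat\gamma(X)J_2, \end{aligned}$$ where $\hat\alpha,\hat\beta,\hat\gamma\in\mathfrak{l}^*$ are the one-forms $$\hat\alpha=-\tfrac12\eta^0-\tfrac{\sqrt3}2\xi_1,\qquad\hat\beta=-\epsilon_1\tfrac{\sqrt3}2\eta^1-\tfrac12\xi_0,\qquad\hat\gamma=\epsilon_2\tfrac12\eta^2-\tfrac{\sqrt3}2\alpha.$$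
   Context: The Lie algebra $\mathfrak{l}$ has basis $(T_1,\dots,T_8)=(V_2,U^2,A,B,V_0,V_1,U^0,U^1)$ with brackets (all not determined by these and skew-symmetry vanish): $[B,A]=\frac1{\sqrt3}A$, $[U^2,V_2]=V_2$, $[V_0,U^0]=-V_2$, $[V_1,U^1]=-V_2$, $[U^2,V_I]=\frac12V_I$ and $[U^2,U^I]=\frac12U^I$ for $I=0,1$, $[B,V_0]=-\frac{\sqrt3}2V_0$, $[B,V_1]=-\frac1{2\sqrt3}V_1$, $[B,U^0]=\frac{\sqrt3}2U^0$, $[B,U^1]=\frac1{2\sqrt3}U^1$, $[A,V_0]=V_1$, $[A,U^1]=-U^0$, $[A,V_1]=-\frac2{\sqrt3}U^1$. The dual basis of $\mathfrak{l}^*$ is denoted $(\eta^2,\xi_2,\alpha,\beta,\eta^0,\eta^1,\xi_0,\xi_1)$, in this order (so $\eta^2(V_2)=1$, $\alpha(A)=1$, $\eta^0(V_0)=1$, $\xi_1(U^1)=1$, etc.). The scalar product $\langle\cdot,\cdot\rangle$ has Gram matrix $\mathrm{diag}(-\epsilon_1,1,-\epsilon_1,1,-\epsilon,-\epsilon_2,-\epsilon_2,-\epsilon)$ in the basis $(T_a)$. Bivectors are identified with skew-symmetric endomorphisms by $(u\wedge v)(w)=u\langle v,w\rangle-\langle u,w\rangle v$. Define $$J_1=\epsilon_2U^2\wedge V_2-B\wedge A+\epsilon\tfrac{\sqrt3}2U^1\wedge U^0-\epsilon_2\tfrac12U^1\wedge V_1+\epsilon_2\tfrac12U^0\wedge V_0+\epsilon\tfrac{\sqrt3}2V_1\wedge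 V_0,$$ $$J_2=\epsilon_2\tfrac{\sqrt3}2U^1\wedge V_2+\epsilon\tfrac12V_0\wedge V_2-\tfrac12U^0\wedge U^2-\epsilon_1\tfrac{\sqrt3}2V_1\wedge U^2-\tfrac12U^1\wedge A-\epsilon_1\tfrac{\sqrt3}2V_0\wedge A-\tfrac{\sqrt3}2U^0\wedge B+\epsilon_1\tfrac12V_1\wedge B,$$ $$J_3=\epsilon_2\tfrac12U^0\wedge V_2-\epsilon\tfrac{\sqrt3}2V_1\wedge V_2-\epsilon_1\tfrac{\sqrt3}2U^1\wedge U^2+\tfrac12V_0\wedge U^2-\tfrac{\sqrt3}2U^0\wedge A+\epsilon_1\tfrac12V_1\wedge A-\epsilon_1\tfrac12U^1\wedge B-\tfrac{\sqrt3}2V_0\wedge B.$$ Elements of $\mathfrak{l}$ are identified with left-invariant vector fields on $L$; $\nabla_X$ is regarded as the endomorphism $Y\mapsto\nabla_XY$ of $\mathfrak{l}$, and $[\cdot,\cdot]$ between endomorphisms is the commutator.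
   Formalization: The η⁰-coefficient of α̂ is taken as ε₁/2 instead of the printed −1/2; they agree when ε₁ = −1, but for (ε₁,ε₂) = (1,−1) the printed formula is false, since [∇_{V₀},J₁]V₂ = ½J₂V₂ forces α̂(V₀) = +½. *)

theory Defs
  imports "HOL-Analysis.Analysis"
begin

section \<open>Smooth manifolds and Lie groups\<close>

primrec Ck_on :: "nat \<Rightarrow> 'v::real_normed_vector set \<Rightarrow> ('v \<Rightarrow> 'w::real_normed_vector) \<Rightarrow> bool" where
  "Ck_on 0 S f \<longleftrightarrow> continuous_on S f"
| "Ck_on (Suc k) S f \<longleftrightarrow>
     f differentiable_on S \<and> (\<forall>v. Ck_on k S (\<lambda>x. frechet_derivative f (at x) v))"

text \<open>Only used for open subsets of Euclidean spaces, where this is the usual \<open>C\<^sup>\<infinity>\<close>.\<close>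

definition smooth_on :: "'v::real_normed_vector set \<Rightarrow> ('v \<Rightarrow> 'w::real_normed_vector) \<Rightarrow> bool" where
  "smooth_on S f \<longleftrightarrow> (\<forall>k. Ck_on k S f)"

text \<open>A chart is a pair of an open domain and a coordinate map; the map is irrelevant outside the
  domain. The manifold is the whole type \<open>'a\<close> and an atlas is a set of charts.\<close>

type_synonym ('a, 'v) chart = "'a set \<times> ('a \<Rightarrow> 'v)"

definition chart_inv :: "('a, 'v) chart \<Rightarrow> 'v \<Rightarrow> 'a" where
  "chart_inv c = inv_into (fst c) (snd c)"

definition is_chart :: "('a::topological_space, 'v::euclidean_space) chart \<Rightarrow> bool" where
  "is_chart c \<longleftrightarrow> open (fst c) \<and> open (snd c ` fst c) \<and>
     homeomorphism (fst c) (snd c ` fst c) (snd c) (chart_inv c)"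

definition is_atlas :: "('a::topological_space, 'v::euclidean_space) chart set \<Rightarrow> bool" where
  "is_atlas \<A> \<longleftrightarrow> (\<forall>c\<in>\<A>. is_chart c) \<and> (\<Union>c\<in>\<A>. fst c) = UNIV \<and>
     (\<forall>c\<in>\<A>. \<forall>d\<in>\<A>. smooth_on (snd c ` (fst c \<inter> fst d)) (snd d \<circ> chart_inv c))"

definition prod_atlas :: "('a, 'v) chart set \<Rightarrow> ('b, 'w) chart set \<Rightarrow> ('a \<times> 'b, 'v \<times> 'w) chart set" where
  "prod_atlas \<A> \<B> = {(fst c \<times> fst d, map_prod (snd c) (snd d)) | c d. c \<in> \<A> \<and> d \<in> \<B>}"

definition smooth_map :: "('a::topological_space, 'v::euclidean_space) chart set \<Rightarrow>
    ('b::topological_space, 'w::euclidean_space) chart set \<Rightarrow> ('a \<Rightarrow> 'b) \<Rightarrow> bool" where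
  "smooth_map \<A> \<B> f \<longleftrightarrow> continuous_on UNIV f \<and>
     (\<forall>c\<in>\<A>. \<forall>d\<in>\<B>. smooth_on (snd c ` (fst c \<inter> f -` fst d)) (snd d \<circ> f \<circ> chart_inv c))"

definition smooth_fun :: "('a::topological_space, 'v::euclidean_space) chart set \<Rightarrow> ('a \<Rightarrow> real) \<Rightarrow> bool" where
  "smooth_fun \<A> f \<longleftrightarrow> (\<forall>c\<in>\<A>. smooth_on (snd c ` fst c) (f \<circ> chart_inv c))"

definition lie_group :: "('a::{t2_space,second_countable_topology}, 'v::euclidean_space) chart set \<Rightarrow>
    ('a \<Rightarrow> 'a \<Rightarrow> 'a) \<Rightarrow> 'a \<Rightarrow> ('a \<Rightarrow> 'a) \<Rightarrow> bool" where
  "lie_group \<A> mul un iv \<longleftrightarrow> is_atlas \<A> \<and> Groups.group mul un iv \<and>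
     smooth_map (prod_atlas \<A> \<A>) \<A> (\<lambda>(x, y). mul x y) \<and> smooth_map \<A> \<A> iv"

section \<open>Vector fields, metrics and connections\<close>

text \<open>The derivative at \<open>p\<close>, in the chart \<open>c\<close>, of a map into a vector space.\<close>

definition chart_deriv :: "('a, 'v::real_normed_vector) chart \<Rightarrow> 'a \<Rightarrow> ('a \<Rightarrow> 'w::real_normed_vector) \<Rightarrow> 'v \<Rightarrow> 'w" where
  "chart_deriv c p f = frechet_derivative (f \<circ> chart_inv c) (at (snd c p))"

text \<open>The differential at \<open>p\<close> of a self-map of the manifold, in a chart \<open>c\<close> around \<open>p\<close> and a chart
  \<open>d\<close> around \<open>f p\<close>. For \<open>f = id\<close> it is the change of components of tangent vectors from \<open>c\<close> to \<open>d\<close>.\<close>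

definition tangent_map :: "('a \<Rightarrow> 'a) \<Rightarrow> ('a, 'v::real_normed_vector) chart \<Rightarrow> ('a, 'v) chart \<Rightarrow> 'a \<Rightarrow> 'v \<Rightarrow> 'v" where
  "tangent_map f c d p = chart_deriv c p (snd d \<circ> f)"

text \<open>A tensor field is given by its components in all charts of the atlas, which are required to
  transform correctly: \<open>X c p\<close> is the coordinate expression in the chart \<open>c\<close> of the value at \<open>p\<close> of
  the vector field \<open>X\<close>, and \<open>G c p\<close> is that of the metric. Vector fields are set to \<open>0\<close> where \<open>c\<close>
  is not a chart around \<open>p\<close>, so that equality of vector fields is equality of functions.\<close>

type_synonym ('a, 'v) vfield = "('a, 'v) chart \<Rightarrow> 'a \<Rightarrow> 'v"
type_synonym ('a, 'v) metric = "('a, 'v) chart \<Rightarrow> 'a \<Rightarrow> 'v \<Rightarrow> 'v \<Rightarrow> real"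

definition vector_fields :: "('a::topological_space, 'v::euclidean_space) chart set \<Rightarrow> ('a, 'v) vfield set" where
  "vector_fields \<A> = {X.
     (\<forall>c p. \<not> (c \<in> \<A> \<and> p \<in> fst c) \<longrightarrow> X c p = 0) \<and>
     (\<forall>c\<in>\<A>. \<forall>d\<in>\<A>. \<forall>p\<in>fst c \<inter> fst d. X d p = tangent_map id c d p (X c p)) \<and>
     (\<forall>c\<in>\<A>. smooth_on (snd c ` fst c) (X c \<circ> chart_inv c))}"

definition vf_add :: "('a, 'v::real_vector) vfield \<Rightarrow> ('a, 'v) vfield \<Rightarrow> ('a, 'v) vfield" where
  "vf_add X Y = (\<lambda>c p. X c p + Y c p)"

definition vf_scale :: "('a \<Rightarrow> real) \<Rightarrow> ('a, 'v::real_vector) vfield \<Rightarrow> ('a, 'v) vfield" where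
  "vf_scale f X = (\<lambda>c p. f p *\<^sub>R X c p)"

text \<open>In coordinates, the vector field of the derivation \<open>f \<mapsto> X (Y f) - Y (X f)\<close>.\<close>

definition vf_bracket :: "('a, 'v::euclidean_space) chart set \<Rightarrow>
    ('a, 'v) vfield \<Rightarrow> ('a, 'v) vfield \<Rightarrow> ('a, 'v) vfield" where
  "vf_bracket \<A> X Y = (\<lambda>c p. if c \<in> \<A> \<and> p \<in> fst c
     then chart_deriv c p (Y c) (X c p) - chart_deriv c p (X c) (Y c p) else 0)"

definition left_invariant_fields :: "('a::topological_space, 'v::euclidean_space) chart set \<Rightarrow>
    ('a \<Rightarrow> 'a \<Rightarrow> 'a) \<Rightarrow> ('a, 'v) vfield set" where
  "left_invariant_fields \<A> mul = {X \<in> vector_fields \<A>.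
     \<forall>h. \<forall>c\<in>\<A>. \<forall>d\<in>\<A>. \<forall>p\<in>fst c. mul h p \<in> fst d \<longrightarrow>
       X d (mul h p) = tangent_map (mul h) c d p (X c p)}"

text \<open>\<open>\<Phi>\<close> identifies the Lie algebra \<open>(UNIV, br)\<close> with the Lie algebra of left-invariant vector fields.\<close>

definition lie_algebra_identification :: "('a::topological_space, 'v::euclidean_space) chart set \<Rightarrow>
    ('a \<Rightarrow> 'a \<Rightarrow> 'a) \<Rightarrow> ('l::real_vector \<Rightarrow> 'l \<Rightarrow> 'l) \<Rightarrow> ('l \<Rightarrow> ('a, 'v) vfield) \<Rightarrow> bool" where
  "lie_algebra_identification \<A> mul br \<Phi> \<longleftrightarrow>
     bij_betw \<Phi> UNIV (left_invariant_fields \<A> mul) \<and>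
     (\<forall>u v. \<Phi> (u + v) = vf_add (\<Phi> u) (\<Phi> v)) \<and>
     (\<forall>r u. \<Phi> (r *\<^sub>R u) = vf_scale (\<lambda>_. r) (\<Phi> u)) \<and>
     (\<forall>u v. \<Phi> (br u v) = vf_bracket \<A> (\<Phi> u) (\<Phi> v))"

definition pseudo_riemannian_metric :: "('a::topological_space, 'v::euclidean_space) chart set \<Rightarrow>
    ('a, 'v) metric \<Rightarrow> bool" where
  "pseudo_riemannian_metric \<A> G \<longleftrightarrow>
     (\<forall>c\<in>\<A>. \<forall>p\<in>fst c. bilinear (G c p) \<and> (\<forall>u v. G c p u v = G c p v u) \<and>
        (\<forall>u. (\<forall>v. G c p u v = 0) \<longrightarrow> u = 0)) \<and>
     (\<forall>c\<in>\<A>. \<forall>d\<in>\<A>. \<forall>p\<in>fst c \<inter> fst d. \<forall>u v.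
        G c p u v = G d p (tangent_map id c d p u) (tangent_map id c d p v)) \<and>
     (\<forall>c\<in>\<A>. \<forall>u v. smooth_on (snd c ` fst c) (\<lambda>x. G c (chart_inv c x) u v))"

definition left_invariant_metric :: "('a::topological_space, 'v::euclidean_space) chart set \<Rightarrow>
    ('a \<Rightarrow> 'a \<Rightarrow> 'a) \<Rightarrow> ('a, 'v) metric \<Rightarrow> bool" where
  "left_invariant_metric \<A> mul G \<longleftrightarrow> pseudo_riemannian_metric \<A> G \<and>
     (\<forall>h. \<forall>c\<in>\<A>. \<forall>d\<in>\<A>. \<forall>p\<in>fst c. mul h p \<in> fst d \<longrightarrow>
       (\<forall>u v. G d (mul h p) (tangent_map (mul h) c d p u) (tangent_map (mul h) c d p v) = G c p u v))"

definition left_invariant_metric_of :: "('a::topological_space, 'v::euclidean_space) chart set \<Rightarrow>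
    ('a \<Rightarrow> 'a \<Rightarrow> 'a) \<Rightarrow> 'a \<Rightarrow> ('l \<Rightarrow> ('a, 'v) vfield) \<Rightarrow> ('l \<Rightarrow> 'l \<Rightarrow> real) \<Rightarrow> ('a, 'v) metric \<Rightarrow> bool" where
  "left_invariant_metric_of \<A> mul un \<Phi> sp G \<longleftrightarrow> left_invariant_metric \<A> mul G \<and>
     (\<forall>c\<in>\<A>. un \<in> fst c \<longrightarrow> (\<forall>u v. G c un (\<Phi> u c un) (\<Phi> v c un) = sp u v))"

definition affine_connection :: "('a::topological_space, 'v::euclidean_space) chart set \<Rightarrow>
    (('a, 'v) vfield \<Rightarrow> ('a, 'v) vfield \<Rightarrow> ('a, 'v) vfield) \<Rightarrow> bool" where
  "affine_connection \<A> D \<longleftrightarrow>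
     (\<forall>X\<in>vector_fields \<A>. \<forall>Y\<in>vector_fields \<A>. D X Y \<in> vector_fields \<A>) \<and>
     (\<forall>X\<in>vector_fields \<A>. \<forall>Y\<in>vector_fields \<A>. \<forall>Z\<in>vector_fields \<A>.
        D (vf_add X Y) Z = vf_add (D X Z) (D Y Z) \<and>
        D X (vf_add Y Z) = vf_add (D X Y) (D X Z)) \<and>
     (\<forall>f. \<forall>X\<in>vector_fields \<A>. \<forall>Y\<in>vector_fields \<A>. smooth_fun \<A> f \<longrightarrow>
        D (vf_scale f X) Y = vf_scale f (D X Y) \<and>
        (\<forall>c\<in>\<A>. \<forall>p\<in>fst c.
           D X (vf_scale f Y) c p = chart_deriv c p f (X c p) *\<^sub>R Y c p + f p *\<^sub>R D X Y c p))"

definition levi_civita_connection :: "('a::topological_space, 'v::euclidean_space) chart set \<Rightarrow>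
    ('a, 'v) metric \<Rightarrow> (('a, 'v) vfield \<Rightarrow> ('a, 'v) vfield \<Rightarrow> ('a, 'v) vfield) \<Rightarrow> bool" where
  "levi_civita_connection \<A> G D \<longleftrightarrow> affine_connection \<A> D \<and>
     (\<forall>X\<in>vector_fields \<A>. \<forall>Y\<in>vector_fields \<A>. \<forall>c\<in>\<A>. \<forall>p\<in>fst c.
        D X Y c p - D Y X c p = vf_bracket \<A> X Y c p) \<and>
     (\<forall>X\<in>vector_fields \<A>. \<forall>Y\<in>vector_fields \<A>. \<forall>Z\<in>vector_fields \<A>. \<forall>c\<in>\<A>. \<forall>p\<in>fst c.
        chart_deriv c p (\<lambda>q. G c q (Y c q) (Z c q)) (X c p) =
          G c p (D X Y c p) (Z c p) + G c p (Y c p) (D X Z c p))"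

text \<open>A connection transported to the Lie algebra along \<open>\<Phi>\<close>; meaningful only if the covariant
  derivative of one left-invariant field along another is left-invariant.\<close>

definition nabla_on :: "('l \<Rightarrow> ('a, 'v) vfield) \<Rightarrow>
    (('a, 'v) vfield \<Rightarrow> ('a, 'v) vfield \<Rightarrow> ('a, 'v) vfield) \<Rightarrow> 'l \<Rightarrow> 'l \<Rightarrow> 'l" where
  "nabla_on \<Phi> D u v = inv \<Phi> (D (\<Phi> u) (\<Phi> v))"

section \<open>The Lie algebra\<close>

type_synonym lalg = "real^8"

abbreviation eV2 :: lalg where "eV2 \<equiv> axis 1 1"
abbreviation eU2 :: lalg where "eU2 \<equiv> axis 2 1"
abbreviation eA :: lalg where "eA \<equiv> axis 3 1"
abbreviation eB :: lalg where "eB \<equiv> axis 4 1"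
abbreviation eV0 :: lalg where "eV0 \<equiv> axis 5 1"
abbreviation eV1 :: lalg where "eV1 \<equiv> axis 6 1"
abbreviation eU0 :: lalg where "eU0 \<equiv> axis 7 1"
abbreviation eU1 :: lalg where "eU1 \<equiv> axis 8 1"

abbreviation eta2 :: "lalg \<Rightarrow> real" where "eta2 \<equiv> \<lambda>x. x $ 1"
abbreviation xi2 :: "lalg \<Rightarrow> real" where "xi2 \<equiv> \<lambda>x. x $ 2"
abbreviation alpha :: "lalg \<Rightarrow> real" where "alpha \<equiv> \<lambda>x. x $ 3"
abbreviation beta :: "lalg \<Rightarrow> real" where "beta \<equiv> \<lambda>x. x $ 4"
abbreviation eta0 :: "lalg \<Rightarrow> real" where "eta0 \<equiv> \<lambda>x. x $ 5"
abbreviation eta1 :: "lalg \<Rightarrow> real" where "eta1 \<equiv> \<lambda>x. x $ 6"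
abbreviation xi0 :: "lalg \<Rightarrow> real" where "xi0 \<equiv> \<lambda>x. x $ 7"
abbreviation xi1 :: "lalg \<Rightarrow> real" where "xi1 \<equiv> \<lambda>x. x $ 8"

definition two_form :: "(lalg \<Rightarrow> real) \<Rightarrow> (lalg \<Rightarrow> real) \<Rightarrow> lalg \<Rightarrow> lalg \<Rightarrow> real" where
  "two_form \<phi> \<psi> u v = \<phi> u * \<psi> v - \<psi> u * \<phi> v"

text \<open>A summand \<open>c * two_form \<phi> \<psi> u v *\<^sub>R z\<close>, with \<open>\<phi>\<close>, \<open>\<psi>\<close> dual to \<open>x\<close>, \<open>y\<close>, contributes \<open>[x, y] = c z\<close>
  (and \<open>[y, x] = - c z\<close>).\<close>

definition lie :: "lalg \<Rightarrow> lalg \<Rightarrow> lalg" where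
  "lie u v =
      (1 / sqrt 3 * two_form beta alpha u v) *\<^sub>R eA
    + two_form xi2 eta2 u v *\<^sub>R eV2
    - two_form eta0 xi0 u v *\<^sub>R eV2
    - two_form eta1 xi1 u v *\<^sub>R eV2
    + (1/2 * two_form xi2 eta0 u v) *\<^sub>R eV0
    + (1/2 * two_form xi2 eta1 u v) *\<^sub>R eV1
    + (1/2 * two_form xi2 xi0 u v) *\<^sub>R eU0
    + (1/2 * two_form xi2 xi1 u v) *\<^sub>R eU1
    - (sqrt 3 / 2 * two_form beta eta0 u v) *\<^sub>R eV0
    - (1 / (2 * sqrt 3) * two_form beta eta1 u v) *\<^sub>R eV1
    + (sqrt 3 / 2 * two_form beta xi0 u v) *\<^sub>R eU0
    + (1 / (2 * sqrt 3) * two_form beta xi1 u v) *\<^sub>R eU1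
    + two_form alpha eta0 u v *\<^sub>R eV1
    - two_form alpha xi1 u v *\<^sub>R eU0
    - (2 / sqrt 3 * two_form alpha eta1 u v) *\<^sub>R eU1"

definition eps :: "real \<Rightarrow> real \<Rightarrow> real" where
  "eps e1 e2 = - e1 * e2"

definition scalar :: "real \<Rightarrow> real \<Rightarrow> lalg \<Rightarrow> lalg \<Rightarrow> real" where
  "scalar e1 e2 u v =
     - e1 * (u $ 1 * v $ 1) + u $ 2 * v $ 2 - e1 * (u $ 3 * v $ 3) + u $ 4 * v $ 4
     - eps e1 e2 * (u $ 5 * v $ 5) - e2 * (u $ 6 * v $ 6) - e2 * (u $ 7 * v $ 7)
     - eps e1 e2 * (u $ 8 * v $ 8)"

definition wedge :: "real \<Rightarrow> real \<Rightarrow> lalg \<Rightarrow> lalg \<Rightarrow> lalg \<Rightarrow> lalg" where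
  "wedge e1 e2 u v w = scalar e1 e2 v w *\<^sub>R u - scalar e1 e2 u w *\<^sub>R v"

definition J1 :: "real \<Rightarrow> real \<Rightarrow> lalg \<Rightarrow> lalg" where
  "J1 e1 e2 w =
      e2 *\<^sub>R wedge e1 e2 eU2 eV2 w
    - wedge e1 e2 eB eA w
    + (eps e1 e2 * (sqrt 3 / 2)) *\<^sub>R wedge e1 e2 eU1 eU0 w
    - (e2 * (1/2)) *\<^sub>R wedge e1 e2 eU1 eV1 w
    + (e2 * (1/2)) *\<^sub>R wedge e1 e2 eU0 eV0 w
    + (eps e1 e2 * (sqrt 3 / 2)) *\<^sub>R wedge e1 e2 eV1 eV0 w"

definition J2 :: "real \<Rightarrow> real \<Rightarrow> lalg \<Rightarrow> lalg" where
  "J2 e1 e2 w =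
      (e2 * (sqrt 3 / 2)) *\<^sub>R wedge e1 e2 eU1 eV2 w
    + (eps e1 e2 * (1/2)) *\<^sub>R wedge e1 e2 eV0 eV2 w
    - (1/2) *\<^sub>R wedge e1 e2 eU0 eU2 w
    - (e1 * (sqrt 3 / 2)) *\<^sub>R wedge e1 e2 eV1 eU2 w
    - (1/2) *\<^sub>R wedge e1 e2 eU1 eA w
    - (e1 * (sqrt 3 / 2)) *\<^sub>R wedge e1 e2 eV0 eA w
    - (sqrt 3 / 2) *\<^sub>R wedge e1 e2 eU0 eB w
    + (e1 * (1/2)) *\<^sub>R wedge e1 e2 eV1 eB w"

definition J3 :: "real \<Rightarrow> real \<Rightarrow> lalg \<Rightarrow> lalg" where
  "J3 e1 e2 w =
      (e2 * (1/2)) *\<^sub>R wedge e1 e2 eU0 eV2 w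
    - (eps e1 e2 * (sqrt 3 / 2)) *\<^sub>R wedge e1 e2 eV1 eV2 w
    - (e1 * (sqrt 3 / 2)) *\<^sub>R wedge e1 e2 eU1 eU2 w
    + (1/2) *\<^sub>R wedge e1 e2 eV0 eU2 w
    - (sqrt 3 / 2) *\<^sub>R wedge e1 e2 eU0 eA w
    + (e1 * (1/2)) *\<^sub>R wedge e1 e2 eV1 eA w
    - (e1 * (1/2)) *\<^sub>R wedge e1 e2 eU1 eB w
    - (sqrt 3 / 2) *\<^sub>R wedge e1 e2 eV0 eB w"

definition commutator :: "('l::group_add \<Rightarrow> 'l) \<Rightarrow> ('l \<Rightarrow> 'l) \<Rightarrow> 'l \<Rightarrow> 'l" where
  "commutator F H = (\<lambda>w. F (H w) - H (F w))"

text \<open>The coefficient of \<open>eta0\<close> is \<open>e1 / 2\<close>. The printed coefficient \<open>- 1 / 2\<close> is the same if \<open>e1 = -1\<close>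
  but wrong for \<open>(e1, e2) = (1, -1)\<close>. There \<open>\<nabla>\<close> maps \<open>(V_0, U^2)\<close> to \<open>- V_0 / 2\<close> and \<open>(V_0, V_2)\<close> to
  \<open>- U^0 / 2\<close>, so \<open>[\<nabla>_{V_0}, J_1] V_2 = sqrt 3 / 4 U^1 - 1/4 V_0\<close>, while
  \<open>J_2 V_2 = sqrt 3 / 2 U^1 - 1/2 V_0\<close>; hence the value at \<open>V_0\<close> is \<open>1/2\<close>.\<close>

definition alpha_hat :: "real \<Rightarrow> real \<Rightarrow> lalg \<Rightarrow> real" where
  "alpha_hat e1 e2 x = e1 * (1/2) * eta0 x - sqrt 3 / 2 * xi1 x"

definition beta_hat :: "real \<Rightarrow> real \<Rightarrow> lalg \<Rightarrow> real" where
  "beta_hat e1 e2 x = - e1 * (sqrt 3 / 2) * eta1 x - 1/2 * xi0 x"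

definition gamma_hat :: "real \<Rightarrow> real \<Rightarrow> lalg \<Rightarrow> real" where
  "gamma_hat e1 e2 x = e2 * (1/2) * eta2 x - sqrt 3 / 2 * alpha x"

end

(* The metric is constant on left-invariant fields, so the Koszul formula makes the Levi-Civita
   connection algebraic: D (Phi x) (Phi y) = Phi (nabla x y), where nabla x y is determined by
   2 <nabla x y, z> = <[x,y],z> - <[y,z],x> + <[z,x],y>. With nabla computed in the basis (T_a),
   the three commutator equations are polynomial identities. *)
theory Submission
  imports Defs
begin

section \<open>The eight basis indices\<close>

lemma exhaust_8: "x = 1 \<or> x = 2 \<or> x = 3 \<or> x = 4 \<or> x = 5 \<or> x = 6 \<or> x = 7 \<or> x = 8" for x :: 8
proof (induct x)
  case (of_int z)
  \<comment> \<open>Type \<open>8\<close> is arithmetic modulo 8: representatives run from 0 to 7,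
    and the numeral \<open>8\<close> denotes 0.\<close>
  then have "z \<in> {0,1,2,3,4,5,6,7}" by auto
  then show ?case by auto
qed

lemma forall_8: "(\<forall>i::8. P i) \<longleftrightarrow> P 1 \<and> P 2 \<and> P 3 \<and> P 4 \<and> P 5 \<and> P 6 \<and> P 7 \<and> P 8"
  by (metis exhaust_8)

section \<open>Left-invariant fields and metrics on the group\<close>

lemma chart_deriv_const_on:
  assumes "open (snd c ` fst c)" "p \<in> fst c" "\<And>q. q \<in> fst c \<Longrightarrow> f q = k"
  shows "chart_deriv c p f v = 0"
proof -
  have "(f \<circ> chart_inv c has_derivative (\<lambda>_. 0)) (at (snd c p))"
  \<comment> \<open>\<open>f \<circ> chart_inv c\<close> is known to be constant only on the chart
    image; being open, that is a neighbourhood of \<open>snd c p\<close>.\<close>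
  proof (rule has_derivative_transform_within_open [OF has_derivative_const])
    show "k = (f \<circ> chart_inv c) x" if "x \<in> snd c ` fst c" for x
      using assms(3) inv_into_into [OF that] by (simp add: chart_inv_def)
  qed (use assms in auto)
  then show ?thesis
    unfolding chart_deriv_def by (simp flip: frechet_derivative_at)
qed

lemma vector_fields_outside:
  assumes "X \<in> vector_fields \<A>" "\<not> (c \<in> \<A> \<and> p \<in> fst c)"
  shows "X c p = 0"
proof -
  have "\<forall>c p. \<not> (c \<in> \<A> \<and> p \<in> fst c) \<longrightarrow> X c p = 0"
    using assms(1) unfolding vector_fields_def by blast
  then show ?thesis
    using assms(2) by blast
qed

lemma identification_field:
  assumes "lie_algebra_identification \<A> mul br \<Phi>"
  shows "\<Phi> u \<in> left_invariant_fields \<A> mul" "\<Phi> u \<in> vector_fields \<A>"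
  using assms bij_betwE
  by (fastforce simp: lie_algebra_identification_def left_invariant_fields_def)+

text \<open>Left translation by \<open>p\<close> carries both the fields and the metric from
  \<open>un\<close> to \<open>p\<close>, so the value is the one prescribed at the unit.\<close>

lemma metric_left_invariant_fields:
  assumes "lie_group \<A> mul un iv" "lie_algebra_identification \<A> mul br \<Phi>"
    and "left_invariant_metric_of \<A> mul un \<Phi> sp G" "d \<in> \<A>" "p \<in> fst d"
  shows "G d p (\<Phi> u d p) (\<Phi> v d p) = sp u v"
proof -
  from assms(1) have "is_atlas \<A>" "Groups.group mul un iv"
    by (simp_all add: lie_group_def)
  then interpret Groups.group mul un iv
    by simp
  obtain c where c: "c \<in> \<A>" "un \<in> fst c"
    using \<open>is_atlas \<A>\<close> unfolding is_atlas_def by blast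
  \<comment> \<open>Left invariance is applied with \<open>h = p\<close> at the point
    \<open>un\<close>; \<open>right_neutral\<close> identifies the target \<open>mul p un\<close>
    with \<open>p\<close>.\<close>
  have "\<Phi> w d p = tangent_map (mul p) c d un (\<Phi> w c un)" for w
    using identification_field(1) [OF assms(2), of w] assms(4,5) c right_neutral [of p]
    unfolding left_invariant_fields_def by (metis (mono_tags, lifting) mem_Collect_eq)
  moreover have "G d p (tangent_map (mul p) c d un a) (tangent_map (mul p) c d un b) = G c un a b" for a b
    using assms(3-5) c right_neutral [of p]
    unfolding left_invariant_metric_of_def left_invariant_metric_def by metis
  ultimately show ?thesis
    using assms(3) c by (simp add: left_invariant_metric_of_def)
qed

section \<open>The Levi-Civita connection on left-invariant fields\<close>

lemma left_invariant_metric_of_at: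
  assumes "left_invariant_metric_of \<A> mul un \<Phi> sp G" "c \<in> \<A>" "p \<in> fst c"
  shows "bilinear (G c p)" "G c p u v = G c p v u" "(\<And>w. G c p u w = 0) \<Longrightarrow> u = 0"
proof -
  have "bilinear (G c p) \<and> (\<forall>u v. G c p u v = G c p v u) \<and> (\<forall>u. (\<forall>v. G c p u v = 0) \<longrightarrow> u = 0)"
    using assms unfolding left_invariant_metric_of_def left_invariant_metric_def
      pseudo_riemannian_metric_def by blast
  then show "bilinear (G c p)" "G c p u v = G c p v u" "(\<And>w. G c p u w = 0) \<Longrightarrow> u = 0"
    by blast+
qed

text \<open>Inner products of left-invariant fields are constant, so the three derivative terms of
  the general Koszul formula vanish and only the bracket terms remain.\<close>

lemma koszul_left_invariant:
  assumes "lie_group \<A> mul un iv" "lie_algebra_identification \<A> mul br \<Phi>"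
    and "left_invariant_metric_of \<A> mul un \<Phi> sp G" "levi_civita_connection \<A> G D"
    and "c \<in> \<A>" "p \<in> fst c"
  shows "2 * G c p (D (\<Phi> x) (\<Phi> y) c p) (\<Phi> z c p) = sp (br x y) z - sp (br y z) x + sp (br z x) y"
proof -
  note field = identification_field(2) [OF assms(2)]
  note G = left_invariant_metric_of_at [OF assms(3,5,6)]
  define g where "g a b e = G c p (D (\<Phi> a) (\<Phi> b) c p) (\<Phi> e c p)" for a b e
  have open_chart: "open (snd c ` fst c)"
    using assms(1,5) unfolding lie_group_def is_atlas_def is_chart_def by blast
  have skew: "g a b e = - g a e b" for a b e
  proof -
    have "chart_deriv c p (\<lambda>q. G c q (\<Phi> b c q) (\<Phi> e c q)) (\<Phi> a c p) = 0"
      by (rule chart_deriv_const_on [OF open_chart assms(6)])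
        (rule metric_left_invariant_fields [OF assms(1-3,5)])
    moreover have "chart_deriv c p (\<lambda>q. G c q (\<Phi> b c q) (\<Phi> e c q)) (\<Phi> a c p) =
        G c p (D (\<Phi> a) (\<Phi> b) c p) (\<Phi> e c p) + G c p (\<Phi> b c p) (D (\<Phi> a) (\<Phi> e) c p)"
      using assms(4-6) field [of a] field [of b] field [of e]
      unfolding levi_civita_connection_def by blast
    ultimately show ?thesis
      using G(2) [of "\<Phi> b c p" "D (\<Phi> a) (\<Phi> e) c p"] by (simp add: g_def)
  qed
  have torsion: "g a b e - g b a e = sp (br a b) e" for a b e
  proof -
    have "D (\<Phi> a) (\<Phi> b) c p - D (\<Phi> b) (\<Phi> a) c p = \<Phi> (br a b) c p"
      using assms(2,4-6) field [of a] field [of b]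
      unfolding levi_civita_connection_def lie_algebra_identification_def by metis
    then show ?thesis
      unfolding g_def bilinear_lsub [OF G(1), symmetric]
      by (simp add: metric_left_invariant_fields [OF assms(1-3,5,6)])
  qed
  \<comment> \<open>Torsion-freeness and metric compatibility give six linear relations among the
    values of \<open>g\<close> at the six permutations of \<open>x\<close>, \<open>y\<close>,
    \<open>z\<close>; they determine \<open>g x y z\<close>.\<close>
  show ?thesis
    using torsion [of x y z] torsion [of y z x] torsion [of z x y]
      skew [of x y z] skew [of y z x] skew [of z x y]
    unfolding g_def [symmetric] by linarith
qed

text \<open>Injectivity of evaluation at \<open>p\<close> comes from the nondegeneracy of \<open>sp\<close>; by dimension
  the left-invariant fields then span the tangent space at \<open>p\<close>, so the Koszul formula on them
  determines \<open>D\<close>.\<close>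

lemma levi_civita_left_invariant:
  fixes \<Phi> :: "'v::euclidean_space \<Rightarrow> ('a::{t2_space,second_countable_topology}, 'v) vfield"
  assumes "lie_group \<A> mul un iv" "lie_algebra_identification \<A> mul br \<Phi>"
    and "left_invariant_metric_of \<A> mul un \<Phi> sp G" "levi_civita_connection \<A> G D"
    and nondegenerate: "\<And>u. (\<And>v. sp u v = 0) \<Longrightarrow> u = 0"
    and koszul: "\<And>z. 2 * sp n z = sp (br x y) z - sp (br y z) x + sp (br z x) y"
  shows "D (\<Phi> x) (\<Phi> y) = \<Phi> n"
proof (intro ext)
  fix c p
  note field = identification_field(2) [OF assms(2)]
  have DV: "D (\<Phi> x) (\<Phi> y) \<in> vector_fields \<A>"
    using assms(4) field unfolding levi_civita_connection_def affine_connection_def by blast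
  show "D (\<Phi> x) (\<Phi> y) c p = \<Phi> n c p"
  proof (cases "c \<in> \<A> \<and> p \<in> fst c")
    case False
    \<comment> \<open>Here both sides are 0 by the convention built into
      \<open>vector_fields\<close>.\<close>
    then show ?thesis
      using vector_fields_outside [OF DV] vector_fields_outside [OF field] by metis
  next
    case True
    then have cp: "c \<in> \<A>" "p \<in> fst c"
      by blast+
    note G = left_invariant_metric_of_at [OF assms(3) cp]
    have sp: "G c p (\<Phi> u c p) (\<Phi> v c p) = sp u v" for u v
      using metric_left_invariant_fields [OF assms(1-3) cp] .
    let ?ev = "\<lambda>u. \<Phi> u c p"
    have "\<Phi> (u + v) = vf_add (\<Phi> u) (\<Phi> v)" "\<Phi> (r *\<^sub>R u) = vf_scale (\<lambda>_. r) (\<Phi> u)" for u v r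
      using assms(2) unfolding lie_algebra_identification_def by blast+
    then have "linear ?ev"
      by (intro linearI) (simp_all add: vf_add_def vf_scale_def)
    moreover have "inj ?ev"
    proof (rule linear_injective_0 [OF \<open>linear ?ev\<close>, THEN iffD2], intro allI impI)
      fix u assume "\<Phi> u c p = 0"
      then show "u = 0"
        using nondegenerate sp [of u] bilinear_lzero [OF G(1)] by metis
    qed
    ultimately have "surj ?ev"
      by (rule linear_inj_imp_surj)
    have "G c p (D (\<Phi> x) (\<Phi> y) c p - \<Phi> n c p) v = 0" for v
    proof -
      obtain z where "v = \<Phi> z c p"
        using \<open>surj ?ev\<close> by (metis surjD)
      then show ?thesis
        using koszul_left_invariant [OF assms(1-4) cp, of x y z] koszul [of z]
        by (simp add: bilinear_lsub [OF G(1)] sp)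
    qed
    then show ?thesis
      using G(3) [of "D (\<Phi> x) (\<Phi> y) c p - \<Phi> n c p"] by simp
  qed
qed

section \<open>Scalar product and explicit connection on the Lie algebra\<close>

lemma scalar_axis: "scalar e1 e2 u (axis i 1) = scalar e1 e2 (axis i 1) (axis i 1) * u $ i"
proof -
  have "\<forall>i. scalar e1 e2 u (axis i 1) = scalar e1 e2 (axis i 1) (axis i 1) * u $ i"
    unfolding forall_8 by (simp add: scalar_def axis_def)
  then show ?thesis ..
qed

text \<open>The Gram matrix is diagonal with nonzero entries, so testing against the basis vectors
  isolates each coordinate.\<close>

lemma scalar_nondegenerate:
  assumes "e1 \<noteq> 0" "e2 \<noteq> 0" "\<And>v. scalar e1 e2 u v = 0"
  shows "u = 0"
proof -
  have "\<forall>i. scalar e1 e2 (axis i 1) (axis i 1) \<noteq> 0"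
    unfolding forall_8 using assms(1,2) by (simp add: scalar_def eps_def axis_def)
  then have "u $ i = 0" for i
    using assms(3) [of "axis i 1"] scalar_axis [of e1 e2 u i] by simp
  then show ?thesis
    by (simp add: vec_eq_iff)
qed

text \<open>The Koszul formula solved in coordinates: the Gram matrix being diagonal, component
  \<open>i\<close> is half the right-hand side at \<open>z = axis i 1\<close> divided by the
  \<open>i\<close>-th diagonal entry. Signs are simplified by
  \<open>e1^2 = e2^2 = 1\<close>.\<close>

definition nabla :: "real \<Rightarrow> real \<Rightarrow> lalg \<Rightarrow> lalg \<Rightarrow> lalg" where
  "nabla e1 e2 x y =
     (- (x$1 * y$2) + (x$7 * y$5 + x$8 * y$6 - x$5 * y$7 - x$6 * y$8) / 2) *\<^sub>R eV2
   + (- e1 * (x$1 * y$1)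
       - (eps e1 e2 * (x$5 * y$5 + x$8 * y$8) + e2 * (x$6 * y$6 + x$7 * y$7)) / 2) *\<^sub>R eU2
   + (- (sqrt 3 / 3 * (x$3 * y$4)) + e2 * (sqrt 3 / 3) * (x$6 * y$8 + x$8 * y$6)
       + eps e1 e2 * (x$7 * y$8 + x$8 * y$7 - x$5 * y$6 - x$6 * y$5) / 2) *\<^sub>R eA
   + (- e1 * (sqrt 3 / 3) * (x$3 * y$3)
       + eps e1 e2 * (sqrt 3 / 2 * (x$5 * y$5) - sqrt 3 / 6 * (x$8 * y$8))
       + e2 * (sqrt 3 / 6 * (x$6 * y$6) - sqrt 3 / 2 * (x$7 * y$7))) *\<^sub>R eB
   + (e2 / 2 * (x$1 * y$7 + x$7 * y$1) + e1 / 2 * (x$3 * y$6 + x$6 * y$3)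
       - x$5 * y$2 / 2 + sqrt 3 / 2 * (x$5 * y$4)) *\<^sub>R eV0
   + (eps e1 e2 / 2 * (x$1 * y$8 + x$8 * y$1) + (x$3 * y$5 - x$5 * y$3) / 2
       - e1 * (sqrt 3 / 3) * (x$3 * y$8 + x$8 * y$3) - x$6 * y$2 / 2
       + sqrt 3 / 6 * (x$6 * y$4)) *\<^sub>R eV1
   + (- eps e1 e2 / 2 * (x$1 * y$5 + x$5 * y$1) + (x$8 * y$3 - x$3 * y$8) / 2
       - x$7 * y$2 / 2 - sqrt 3 / 2 * (x$7 * y$4)) *\<^sub>R eU0
   + (- e2 / 2 * (x$1 * y$6 + x$6 * y$1) + sqrt 3 / 3 * (x$6 * y$3 - x$3 * y$6)
       - e1 / 2 * (x$3 * y$7 + x$7 * y$3) - x$8 * y$2 / 2 - sqrt 3 / 6 * (x$8 * y$4)) *\<^sub>R eU1"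

section \<open>Coordinate identities for the connection and the three endomorphisms\<close>

lemma nabla_nth:
  "nabla e1 e2 x y $ 1 = - (x$1 * y$2) + (x$7 * y$5 + x$8 * y$6 - x$5 * y$7 - x$6 * y$8) / 2"
  "nabla e1 e2 x y $ 2 = - e1 * (x$1 * y$1)
       - (eps e1 e2 * (x$5 * y$5 + x$8 * y$8) + e2 * (x$6 * y$6 + x$7 * y$7)) / 2"
  "nabla e1 e2 x y $ 3 = - (sqrt 3 / 3 * (x$3 * y$4)) + e2 * (sqrt 3 / 3) * (x$6 * y$8 + x$8 * y$6)
       + eps e1 e2 * (x$7 * y$8 + x$8 * y$7 - x$5 * y$6 - x$6 * y$5) / 2"
  "nabla e1 e2 x y $ 4 = - e1 * (sqrt 3 / 3) * (x$3 * y$3)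
       + eps e1 e2 * (sqrt 3 / 2 * (x$5 * y$5) - sqrt 3 / 6 * (x$8 * y$8))
       + e2 * (sqrt 3 / 6 * (x$6 * y$6) - sqrt 3 / 2 * (x$7 * y$7))"
  "nabla e1 e2 x y $ 5 = e2 / 2 * (x$1 * y$7 + x$7 * y$1) + e1 / 2 * (x$3 * y$6 + x$6 * y$3)
       - x$5 * y$2 / 2 + sqrt 3 / 2 * (x$5 * y$4)"
  "nabla e1 e2 x y $ 6 = eps e1 e2 / 2 * (x$1 * y$8 + x$8 * y$1) + (x$3 * y$5 - x$5 * y$3) / 2
       - e1 * (sqrt 3 / 3) * (x$3 * y$8 + x$8 * y$3) - x$6 * y$2 / 2 + sqrt 3 / 6 * (x$6 * y$4)"
  "nabla e1 e2 x y $ 7 = - eps e1 e2 / 2 * (x$1 * y$5 + x$5 * y$1) + (x$8 * y$3 - x$3 * y$8) / 2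
       - x$7 * y$2 / 2 - sqrt 3 / 2 * (x$7 * y$4)"
  "nabla e1 e2 x y $ 8 = - e2 / 2 * (x$1 * y$6 + x$6 * y$1) + sqrt 3 / 3 * (x$6 * y$3 - x$3 * y$6)
       - e1 / 2 * (x$3 * y$7 + x$7 * y$3) - x$8 * y$2 / 2 - sqrt 3 / 6 * (x$8 * y$4)"
  by (simp_all add: nabla_def axis_def)

text \<open>The sign condition enters through \<open>e1^2 = e2^2 = 1\<close>, which turns products
  such as \<open>eps e1 e2 * e2\<close> into \<open>- e1\<close>; \<open>J2_nth\<close> and
  \<open>J3_nth\<close> are normalised in the same way.\<close>

lemma J1_nth:
  assumes "(e1, e2) \<in> {(-1, -1), (-1, 1), (1, -1)}"
  shows
    "J1 e1 e2 w $ 1 = - (e2 * w $ 2)"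
    "J1 e1 e2 w $ 2 = eps e1 e2 * w $ 1"
    "J1 e1 e2 w $ 3 = w $ 4"
    "J1 e1 e2 w $ 4 = e1 * w $ 3"
    "J1 e1 e2 w $ 5 = w $ 7 / 2 - sqrt 3 / 2 * e1 * w $ 6"
    "J1 e1 e2 w $ 6 = e1 * w $ 8 / 2 - sqrt 3 / 2 * w $ 5"
    "J1 e1 e2 w $ 7 = sqrt 3 / 2 * w $ 8 + e1 * w $ 5 / 2"
    "J1 e1 e2 w $ 8 = sqrt 3 / 2 * e1 * w $ 7 + w $ 6 / 2"
  using assms by (auto simp: J1_def wedge_def scalar_def eps_def axis_def)

lemma J2_nth:
  assumes "(e1, e2) \<in> {(-1, -1), (-1, 1), (1, -1)}"
  shows
    "J2 e1 e2 w $ 1 = - (sqrt 3 / 2 * e1 * w $ 8) + w $ 5 / 2"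
    "J2 e1 e2 w $ 2 = - (e2 * w $ 7 / 2) + sqrt 3 / 2 * eps e1 e2 * w $ 6"
    "J2 e1 e2 w $ 3 = - (eps e1 e2 * w $ 8 / 2) + sqrt 3 / 2 * e2 * w $ 5"
    "J2 e1 e2 w $ 4 = - (sqrt 3 / 2 * e2 * w $ 7) - eps e1 e2 * w $ 6 / 2"
    "J2 e1 e2 w $ 5 = e2 * w $ 1 / 2 + sqrt 3 / 2 * w $ 3"
    "J2 e1 e2 w $ 6 = - (sqrt 3 / 2 * e1 * w $ 2) + e1 * w $ 4 / 2"
    "J2 e1 e2 w $ 7 = - w $ 2 / 2 - sqrt 3 / 2 * w $ 4"
    "J2 e1 e2 w $ 8 = sqrt 3 / 2 * eps e1 e2 * w $ 1 + e1 * w $ 3 / 2"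
  using assms by (auto simp: J2_def wedge_def scalar_def eps_def axis_def)

lemma J3_nth:
  assumes "(e1, e2) \<in> {(-1, -1), (-1, 1), (1, -1)}"
  shows
    "J3 e1 e2 w $ 1 = w $ 7 / 2 + sqrt 3 / 2 * e1 * w $ 6"
    "J3 e1 e2 w $ 2 = sqrt 3 / 2 * e2 * w $ 8 + eps e1 e2 * w $ 5 / 2"
    "J3 e1 e2 w $ 3 = - (sqrt 3 / 2 * e2 * w $ 7) - eps e1 e2 * w $ 6 / 2"
    "J3 e1 e2 w $ 4 = e2 * w $ 8 / 2 - sqrt 3 / 2 * eps e1 e2 * w $ 5"
    "J3 e1 e2 w $ 5 = w $ 2 / 2 - sqrt 3 / 2 * w $ 4"
    "J3 e1 e2 w $ 6 = - (sqrt 3 / 2 * e2 * w $ 1) - w $ 3 / 2"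
    "J3 e1 e2 w $ 7 = eps e1 e2 * w $ 1 / 2 + sqrt 3 / 2 * e1 * w $ 3"
    "J3 e1 e2 w $ 8 = - (sqrt 3 / 2 * e1 * w $ 2) - e1 * w $ 4 / 2"
  using assms by (auto simp: J3_def wedge_def scalar_def eps_def axis_def)

text \<open>These rules bring coefficients to the form \<open>a + b * sqrt 3\<close> with rational
  \<open>a\<close>, \<open>b\<close>, so that polynomials can be compared termwise. The first is
  right-nested to match the products left by \<open>algebra_simps\<close>.\<close>

lemma sqrt3_simps:
  "sqrt 3 * (sqrt 3 * t) = 3 * t" "1 / sqrt 3 = sqrt 3 / 3" "1 / (2 * sqrt 3) = sqrt 3 / 6"
  "2 / sqrt 3 = 2 * sqrt 3 / 3"
  by (simp_all add: real_div_sqrt field_simps flip: mult.assoc)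

lemma nabla_koszul:
  assumes "(e1, e2) \<in> {(-1, -1), (-1, 1), (1, -1)}"
  shows "2 * scalar e1 e2 (nabla e1 e2 x y) z =
    scalar e1 e2 (lie x y) z - scalar e1 e2 (lie y z) x + scalar e1 e2 (lie z x) y"
  using assms unfolding lie_def sqrt3_simps
  \<comment> \<open>Each sign pair is substituted as numerals, leaving an identity between trilinear
    polynomials in the coordinates of \<open>x\<close>, \<open>y\<close>, \<open>z\<close>.\<close>
  by (elim insertE emptyE; simp only: prod.inject; elim conjE; hypsubst;
      simp add: nabla_def scalar_def two_form_def eps_def axis_def;
      simp add: algebra_simps add_divide_distrib diff_divide_distrib)

text \<open>Both sides are bilinear in \<open>x\<close> and \<open>w\<close>; for each sign pair
  every component is an identity between polynomials in their coordinates.\<close>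

lemma commutator_nabla:
  assumes "(e1, e2) \<in> {(-1, -1), (-1, 1), (1, -1)}"
  shows "commutator (nabla e1 e2 x) (J1 e1 e2) w =
      alpha_hat e1 e2 x *\<^sub>R J2 e1 e2 w + beta_hat e1 e2 x *\<^sub>R J3 e1 e2 w" (is ?t1)
    and "commutator (nabla e1 e2 x) (J2 e1 e2) w =
      (eps e1 e2 * alpha_hat e1 e2 x) *\<^sub>R J1 e1 e2 w
       + gamma_hat e1 e2 x *\<^sub>R J3 e1 e2 w" (is ?t2)
    and "commutator (nabla e1 e2 x) (J3 e1 e2) w =
      (e2 * beta_hat e1 e2 x) *\<^sub>R J1 e1 e2 w
       + (e1 * gamma_hat e1 e2 x) *\<^sub>R J2 e1 e2 w" (is ?t3)
proof -
  note nths = nabla_nth J1_nth [OF assms] J2_nth [OF assms] J3_nth [OF assms]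
  note hats = eps_def alpha_hat_def beta_hat_def gamma_hat_def
  note expand = algebra_simps add_divide_distrib diff_divide_distrib sqrt3_simps(1)
  \<comment> \<open>In this form each case consists of equations that can be substituted
    directly.\<close>
  have "e1 = 1 \<and> e2 = -1 \<or> e1 = -1 \<and> (e2 = 1 \<or> e2 = -1)"
    using assms by auto
  then show ?t1 ?t2 ?t3
    unfolding vec_eq_iff forall_8 commutator_def
      vector_minus_component vector_add_component vector_scaleR_component nths hats
    by (elim disjE conjE; hypsubst; intro conjI; simp add: expand)+
qed

theorem proposition12:
  fixes e1 e2 :: real
    and \<A> :: "('a::{t2_space,second_countable_topology}, real^8) chart set"
    and mul :: "'a \<Rightarrow> 'a \<Rightarrow> 'a" and un :: 'a and iv :: "'a \<Rightarrow> 'a"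
    and \<Phi> :: "lalg \<Rightarrow> ('a, real^8) vfield"
    and G :: "('a, real^8) metric"
    and D :: "('a, real^8) vfield \<Rightarrow> ('a, real^8) vfield \<Rightarrow> ('a, real^8) vfield"
  assumes "(e1, e2) \<in> {(-1, -1), (-1, 1), (1, -1)}"
    and "lie_group \<A> mul un iv"
    and "simply_connected (UNIV :: 'a set)"
    and "lie_algebra_identification \<A> mul lie \<Phi>"
    and "left_invariant_metric_of \<A> mul un \<Phi> (scalar e1 e2) G"
    and "levi_civita_connection \<A> G D"
  shows "\<forall>x. (\<forall>y. D (\<Phi> x) (\<Phi> y) \<in> range \<Phi>) \<and>
    commutator (nabla_on \<Phi> D x) (J1 e1 e2) =
      (\<lambda>w. alpha_hat e1 e2 x *\<^sub>R J2 e1 e2 w + beta_hat e1 e2 x *\<^sub>R J3 e1 e2 w) \<and>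
    commutator (nabla_on \<Phi> D x) (J2 e1 e2) =
      (\<lambda>w. (eps e1 e2 * alpha_hat e1 e2 x) *\<^sub>R J1 e1 e2 w + gamma_hat e1 e2 x *\<^sub>R J3 e1 e2 w) \<and>
    commutator (nabla_on \<Phi> D x) (J3 e1 e2) =
      (\<lambda>w. (e2 * beta_hat e1 e2 x) *\<^sub>R J1 e1 e2 w + (e1 * gamma_hat e1 e2 x) *\<^sub>R J2 e1 e2 w)"
proof -
  \<comment> \<open>The signs are nonzero, so \<open>scalar\<close> is nondegenerate and
    \<open>nabla_koszul\<close> identifies the covariant derivative.\<close>
  have D: "D (\<Phi> x) (\<Phi> y) = \<Phi> (nabla e1 e2 x y)" for x y
    by (rule levi_civita_left_invariant [OF assms(2,4-6)])
      (use scalar_nondegenerate [of e1 e2] nabla_koszul [OF assms(1)] assms(1) in auto)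
  \<comment> \<open>\<open>nabla_on\<close> is defined with \<open>inv \<Phi>\<close>, which
    recovers \<open>nabla\<close> from \<open>D\<close> by injectivity.\<close>
  have "inj \<Phi>"
    using assms(4) by (simp add: lie_algebra_identification_def bij_betw_def)
  then have nabla_on: "nabla_on \<Phi> D = nabla e1 e2"
    by (simp add: nabla_on_def D fun_eq_iff)
  show ?thesis
    unfolding nabla_on by (simp add: D rangeI commutator_nabla [OF assms(1)] fun_eq_iff)
qed

end
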